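(* Assume that $\varphi$ has accuracy $\kappa$ and that the translates $\{\varphi(\cdot-k)\}_{k\in\Gamma}$ are linearly independent. Let $n\ge0$ and let $\Delta_n$ be the set of eigenvalues of $T_n$. If $q$ is a homogeneous polynomial in $\mathbb{R}^d$ with $\deg(q)<\kappa$, then $q\in\mathcal{H}=\bigoplus_{\lambda\in\Delta_n}\mathcal{H}_\lambda(\varphi)$.
   Context: $\Gamma\subset\mathbb{R}^d$ is a lattice (the image of $\mathbb{Z}^d$ under a nonsingular linear map) and $A$ is a dilation matrix associated to $\Gamma$: a $d\times d$ real matrix with $A(\Gamma)\subset\Gamma$ all of whose eigenvalues have modulus $>1$. $\Lambda\subset\Gamma$ is finite and nonempty, $c_k\in\mathbb{C}$ for $k\in\Lambda$, $c_k=0$ for $k\in\Gamma\setminus\Lambda$. $\varphi:\mathbb{R}^d\to\mathbb{C}$ is a compactly supported function satisfying $\varphi(x)=\sum_{k\in\Lambda}c_k\varphi(Ax-k)$ for $x\in\mathbb{R}^d$. $\ell(\Gamma)$ is the space of all complex sequences $\{y_k\}_{k\in\Gamma}$. $\mathcal{S}(\varphi)$ is the set of all functions $f(x)=\sum_{k\in\Gamma}y_k\varphi(x+k)$, $\{y_k\}\in\ell(\Gamma)$. The translates are linearly independent if $\sum_{k\in\Gamma}\alpha_k\varphi(\cdot-k)\equiv0$ with $\{\alpha_k\}\in\ell(\Gamma)$ implies all $\alpha_k=0$. The accuracy of $\varphi$ is the largest integer $\kappa$ such that all multivariate polynomials $q$ with $\deg(q)<\kappa$ are in $\mathcal{S}(\varphi)$.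 A function $h:\mathbb{R}^d\to\mathbb{C}$ is in the class $\mathcal{H}(A,\lambda,r)$ ($\lambda\in\mathbb{C}$, $r\ge1$) if $\sum_{k=0}^r\binom{r}{k}(-\lambda)^kh(A^{k-r}x)=0$ for every $x\in\mathbb{R}^d$; equivalently $(D_A-\lambda I)^rh=0$ with $(D_Af)(x)=f(A^{-1}x)$. For $\lambda\in\Delta_n$, $\mathcal{H}_\lambda(\varphi)=\{h\in\mathcal{S}(\varphi): h\in\mathcal{H}(A,\lambda,k)\text{ for some }k\ge1\}$. For a finite nonempty $H\subset\Gamma$ and $B\subset\mathbb{R}^d$ let $w_H(B)=A^{-1}(B+H)$; $K_H$ is the unique nonempty compact set with $w_H(K_H)=K_H$, and $\Omega_H=K_H\cap\Gamma$. A set $\Omega\subset\Gamma$ is $H$-admissible if $w_H(\Omega)\cap\Gamma\subset\Omega$. $D\subset\Gamma$ is a full set of representatives of $\Gamma/A(\Gamma)$ with $0\in D$, such that the translates $K_D+k$, $k\in\Gamma$, of $Q=K_D$ cover $\mathbb{R}^d$ with overlaps of measure zero. $\Lambda'=\Lambda-D$ and $\Omega'=K_{\Lambda'}\cap\Gamma$. $\{\Omega_n\}_{n\ge0}$ is a fixed sequence of finite subsets of $\Gamma$ such that: $\Omega_0=\Omega_\Lambda$; $\Omega_i\subsetneq\Omega_{i+1}$ for all $i\ge 0$ and $\bigcup_i\Omega_i=\Gamma$; each $\Omega_i$ is $\Lambda$-admissible and $w_\Lambda(\Omega_{i+1})\cap\Gamma\subset\Omega_i$ for all $i\ge 0$;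 $\Omega_{n_0}=\Omega'$ for some index $n_0$; and for $i\ge n_0$, $\Omega_i$ is $\Lambda'$-admissible and $w_{\Lambda'}(\Omega_{i+1})\cap\Gamma\subset\Omega_i$. $T_n=[c_{Ai-j}]_{i,j\in\Omega_n}$. *)

theory Defs
  imports "HOL-Analysis.Analysis"
begin

definition is_lattice :: "(real ^ 'd) set \<Rightarrow> bool" where
  "is_lattice \<Gamma> \<longleftrightarrow>
     (\<exists>B :: real ^ 'd ^ 'd. invertible B \<and> \<Gamma> = (\<lambda>z. B *v z) ` {z. \<forall>i. z $ i \<in> \<int>})"

text \<open>The eigenvalues are the complex ones, so the real matrix is first complexified.\<close>

definition is_dilation_matrix :: "(real ^ 'd) set \<Rightarrow> real ^ 'd ^ 'd \<Rightarrow> bool" where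
  "is_dilation_matrix \<Gamma> A \<longleftrightarrow>
     (\<lambda>x. A *v x) ` \<Gamma> \<subseteq> \<Gamma> \<and>
     (\<forall>(\<mu>::complex) v. v \<noteq> 0 \<and> (\<chi> i j. complex_of_real (A $ i $ j)) *v v = \<mu> *s v \<longrightarrow> cmod \<mu> > 1)"

definition full_representatives :: "(real ^ 'd) set \<Rightarrow> real ^ 'd ^ 'd \<Rightarrow> (real ^ 'd) set \<Rightarrow> bool" where
  "full_representatives \<Gamma> A D \<longleftrightarrow>
     D \<subseteq> \<Gamma> \<and> (\<forall>g\<in>\<Gamma>. \<exists>!e. e \<in> D \<and> g - e \<in> (\<lambda>x. A *v x) ` \<Gamma>)"

definition w_map :: "real ^ 'd ^ 'd \<Rightarrow> (real ^ 'd) set \<Rightarrow> (real ^ 'd) set \<Rightarrow> (real ^ 'd) set" where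
  "w_map A H B = (\<lambda>x. matrix_inv A *v x) ` {b + h | b h. b \<in> B \<and> h \<in> H}"

text \<open>For a dilation matrix and a finite nonempty set of digits, existence and uniqueness of
  this compact set are Hutchinson's theorem, applied with a norm in which the inverse of the
  matrix is a contraction.\<close>

definition attractor :: "real ^ 'd ^ 'd \<Rightarrow> (real ^ 'd) set \<Rightarrow> (real ^ 'd) set" where
  "attractor A H = (THE K. K \<noteq> {} \<and> compact K \<and> w_map A H K = K)"

definition lattice_attractor ::
  "(real ^ 'd) set \<Rightarrow> real ^ 'd ^ 'd \<Rightarrow> (real ^ 'd) set \<Rightarrow> (real ^ 'd) set" where
  "lattice_attractor \<Gamma> A H = attractor A H \<inter> \<Gamma>"

definition admissible ::
  "(real ^ 'd) set \<Rightarrow> real ^ 'd ^ 'd \<Rightarrow> (real ^ 'd) set \<Rightarrow> (real ^ 'd) set \<Rightarrow> bool" where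
  "admissible \<Gamma> A H \<Omega> \<longleftrightarrow> \<Omega> \<subseteq> \<Gamma> \<and> w_map A H \<Omega> \<inter> \<Gamma> \<subseteq> \<Omega>"

definition tiles_by :: "(real ^ 'd) set \<Rightarrow> (real ^ 'd) set \<Rightarrow> bool" where
  "tiles_by \<Gamma> Q \<longleftrightarrow>
     (\<Union>k\<in>\<Gamma>. (\<lambda>x. x + k) ` Q) = UNIV \<and>
     (\<forall>k\<in>\<Gamma>. \<forall>l\<in>\<Gamma>. k \<noteq> l \<longrightarrow> negligible ((\<lambda>x. x + k) ` Q \<inter> (\<lambda>x. x + l) ` Q))"

definition minus_set :: "(real ^ 'd) set \<Rightarrow> (real ^ 'd) set \<Rightarrow> (real ^ 'd) set" where
  "minus_set X Y = {x - y | x y. x \<in> X \<and> y \<in> Y}"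

definition compactly_supported :: "(real ^ 'd \<Rightarrow> complex) \<Rightarrow> bool" where
  "compactly_supported f \<longleftrightarrow> compact (closure {x. f x \<noteq> 0})"

text \<open>If \<open>\<phi>\<close> is compactly supported and \<open>\<Gamma>\<close> is a lattice, then for each \<open>x\<close> only finitely many
  terms \<open>y k * \<phi> (x + k)\<close> are nonzero, so the sums below are finite at every point and no
  condition on the coefficient sequence is needed.  Coefficients outside \<open>\<Gamma>\<close> are irrelevant.\<close>

definition shift_space :: "(real ^ 'd) set \<Rightarrow> (real ^ 'd \<Rightarrow> complex) \<Rightarrow> (real ^ 'd \<Rightarrow> complex) set" where
  "shift_space \<Gamma> \<phi> = {f. \<exists>y. \<forall>x. ((\<lambda>k. y k * \<phi> (x + k)) has_sum f x) \<Gamma>}"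

definition independent_translates :: "(real ^ 'd) set \<Rightarrow> (real ^ 'd \<Rightarrow> complex) \<Rightarrow> bool" where
  "independent_translates \<Gamma> \<phi> \<longleftrightarrow>
     (\<forall>\<alpha>. (\<forall>x. ((\<lambda>k. \<alpha> k * \<phi> (x - k)) has_sum 0) \<Gamma>) \<longrightarrow> (\<forall>k\<in>\<Gamma>. \<alpha> k = 0))"

definition monomial_fun :: "('d::finite \<Rightarrow> nat) \<Rightarrow> real ^ 'd \<Rightarrow> complex" where
  "monomial_fun \<alpha> x = (\<Prod>i\<in>UNIV. complex_of_real (x $ i) ^ \<alpha> i)"

text \<open>The sets of multi-indices below are finite.  The zero polynomial has degree less than every
  bound, and it is homogeneous of every degree.\<close>

definition poly_degree_less :: "nat \<Rightarrow> (real ^ 'd::finite \<Rightarrow> complex) \<Rightarrow> bool" where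
  "poly_degree_less m q \<longleftrightarrow>
     (\<exists>a. q = (\<lambda>x. \<Sum>\<alpha> | (\<Sum>i\<in>UNIV. \<alpha> i) < m. a \<alpha> * monomial_fun \<alpha> x))"

definition homogeneous_poly :: "(real ^ 'd::finite \<Rightarrow> complex) \<Rightarrow> bool" where
  "homogeneous_poly q \<longleftrightarrow>
     (\<exists>m a. q = (\<lambda>x. \<Sum>\<alpha> | (\<Sum>i\<in>UNIV. \<alpha> i) = (m::nat). a \<alpha> * monomial_fun \<alpha> x))"

definition has_accuracy :: "(real ^ 'd::finite) set \<Rightarrow> (real ^ 'd \<Rightarrow> complex) \<Rightarrow> nat \<Rightarrow> bool" where
  "has_accuracy \<Gamma> \<phi> \<kappa> \<longleftrightarrow>
     (\<forall>q. poly_degree_less \<kappa> q \<longrightarrow> q \<in> shift_space \<Gamma> \<phi>) \<and>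
     (\<forall>\<kappa>'. (\<forall>q. poly_degree_less \<kappa>' q \<longrightarrow> q \<in> shift_space \<Gamma> \<phi>) \<longrightarrow> \<kappa>' \<le> \<kappa>)"

text \<open>This is the binomial expansion of \<open>(T - \<mu> I)\<^sup>r h = 0\<close>, where \<open>T\<close> composes a function with the
  inverse of \<open>A\<close>.  The power \<open>A\<^bsup>k - r\<^esup>\<close>, with \<open>k \<le> r\<close>, is the \<open>(r - k)\<close>-fold iterate of the inverse of \<open>A\<close>.\<close>

definition homogeneity_class ::
  "real ^ 'd ^ 'd \<Rightarrow> complex \<Rightarrow> nat \<Rightarrow> (real ^ 'd \<Rightarrow> complex) set" where
  "homogeneity_class A \<mu> r =
     {h. \<forall>x. (\<Sum>k\<le>r. of_nat (r choose k) * (- \<mu>) ^ k *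
               h (((\<lambda>y. matrix_inv A *v y) ^^ (r - k)) x)) = 0}"

definition H_space ::
  "(real ^ 'd) set \<Rightarrow> real ^ 'd ^ 'd \<Rightarrow> (real ^ 'd \<Rightarrow> complex) \<Rightarrow> complex \<Rightarrow> (real ^ 'd \<Rightarrow> complex) set" where
  "H_space \<Gamma> A \<phi> \<mu> = {h \<in> shift_space \<Gamma> \<phi>. \<exists>k\<ge>1. h \<in> homogeneity_class A \<mu> k}"

definition eigenvalues_on :: "'i set \<Rightarrow> ('i \<Rightarrow> 'i \<Rightarrow> complex) \<Rightarrow> complex set" where
  "eigenvalues_on I M =
     {\<mu>. \<exists>v. (\<exists>i\<in>I. v i \<noteq> 0) \<and> (\<forall>i\<in>I. (\<Sum>j\<in>I. M i j * v j) = \<mu> * v i)}"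

definition sum_of_spaces :: "'i set \<Rightarrow> ('i \<Rightarrow> ('a \<Rightarrow> complex) set) \<Rightarrow> ('a \<Rightarrow> complex) set" where
  "sum_of_spaces I V =
     {\<lambda>x. \<Sum>i\<in>F. h i x | F h. finite F \<and> F \<subseteq> I \<and> (\<forall>i\<in>F. h i \<in> V i)}"

definition independent_spaces :: "'i set \<Rightarrow> ('i \<Rightarrow> ('a \<Rightarrow> complex) set) \<Rightarrow> bool" where
  "independent_spaces I V \<longleftrightarrow>
     (\<forall>F h. finite F \<and> F \<subseteq> I \<and> (\<forall>i\<in>F. h i \<in> V i) \<and> (\<forall>x. (\<Sum>i\<in>F. h i x) = 0)
        \<longrightarrow> (\<forall>i\<in>F. \<forall>x. h i x = 0))"

end

theory Submission
  imports Defs "HOL-Library.Function_Algebras"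
    "HOL-Computational_Algebra.Fundamental_Theorem_Algebra"
    "HOL-Computational_Algebra.Polynomial_Factorial"
    "HOL-Computational_Algebra.Field_as_Ring"
begin

text \<open>
  Let \<open>U\<close> denote the operator that composes a function with the inverse of the dilation matrix.  The
  polynomials of degree less than \<open>\<kappa>\<close> form a finite-dimensional space which \<open>U\<close> maps into itself and which,
  by accuracy, lies in the shift space.  On such a space every vector \<open>q\<close> is killed by some nonzero
  polynomial in \<open>U\<close> (\<open>annihilating_poly_exists\<close>), and a factorization of this polynomial over the complex
  numbers splits \<open>q\<close> into nonzero generalized eigenfunctions (\<open>annihilated_decomposition\<close>).  The components
  are images of \<open>q\<close> under polynomials in \<open>U\<close>, so they are again polynomials of degree less than \<open>\<kappa>\<close> and
  belong to the shift space.  Functions in the homogeneity class of \<open>\<lambda>\<close> are exactly those killed by a power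
  of \<open>U - \<lambda>\<close>, so it remains to see that the values \<open>\<lambda>\<close> which occur are eigenvalues of the finite matrix
  \<open>T\<^sub>n\<close>.

  Each component yields a true eigenfunction \<open>f = (\<Sum>k. y k * \<phi> (\<cdot> + k))\<close> in the shift space, with \<open>\<lambda> \<noteq> 0\<close> because
  \<open>U\<close> is invertible.  By the refinement equation, \<open>U\<close> multiplies the coefficient row \<open>y\<close> by the bi-infinite
  matrix \<open>[c\<^bsub>Ai-j\<^esub>]\<close> (\<open>expansion_of_dilated\<close>), and linear independence of the translates makes \<open>y\<close> a left
  eigenvector of that matrix.  Admissibility of \<open>\<Omega> n\<close> says that the restriction of \<open>y\<close> to \<open>\<Omega> n\<close> satisfies the
  eigenvalue equation for \<open>T\<^sub>n\<close>.  This restriction is not zero: otherwise the inclusions between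
  consecutive sets \<open>\<Omega> i\<close> would propagate the zeros of \<open>y\<close> to the whole lattice
  (\<open>eigenfunction_eigenvalue\<close>).  Finally, a left eigenvalue of a finite matrix is also a right one
  (\<open>left_eigenvector_imp_eigenvalue\<close>).

  The sum of the spaces is direct for a reason independent of the shift space: generalized
  eigenfunctions for distinct eigenvalues of any linear operator are independent, which follows from
  the Bezout identity for coprime powers of linear polynomials.
\<close>

section \<open>Polynomials in a composition operator\<close>

text \<open>The value at \<open>f\<close> of the polynomial \<open>p\<close> in the operator that composes a function with \<open>s\<close>.\<close>

definition poly_action :: "('a \<Rightarrow> 'a) \<Rightarrow> complex poly \<Rightarrow> ('a \<Rightarrow> complex) \<Rightarrow> 'a \<Rightarrow> complex" where
  "poly_action s p f x = (\<Sum>k\<le>degree p. coeff p k * f ((s ^^ k) x))"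

lemma poly_action_eq_sum:
  "degree p \<le> N \<Longrightarrow> poly_action s p f x = (\<Sum>k\<le>N. coeff p k * f ((s ^^ k) x))"
  unfolding poly_action_def
  by (rule sum.mono_neutral_left) (auto intro: coeff_eq_0)

lemma poly_action_0 [simp]: "poly_action s 0 f x = 0"
  by (simp add: poly_action_def)

lemma poly_action_1 [simp]: "poly_action s 1 f x = f x"
  by (simp add: poly_action_def)

lemma poly_action_pCons:
  "poly_action s (pCons a p) f x = a * f x + poly_action s p f (s x)"
proof -
  have "poly_action s (pCons a p) f x
      = (\<Sum>k\<le>Suc (degree p). coeff (pCons a p) k * f ((s ^^ k) x))"
    by (rule poly_action_eq_sum) (rule degree_pCons_le)
  also have "\<dots> = a * f x + (\<Sum>k\<le>degree p. coeff p k * f ((s ^^ k) (s x)))"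
    by (simp add: sum.atMost_Suc_shift funpow_swap1 del: sum.atMost_Suc)
  finally show ?thesis
    by (simp add: poly_action_def)
qed

lemma poly_action_add:
  "poly_action s (p + q) f x = poly_action s p f x + poly_action s q f x"
proof -
  define N where "N = max (degree p) (degree q)"
  have "degree p \<le> N" "degree q \<le> N" "degree (p + q) \<le> N"
    by (auto simp: N_def degree_add_le_max)
  then show ?thesis
    by (simp add: poly_action_eq_sum[of _ N] sum.distrib algebra_simps)
qed

lemma poly_action_smult: "poly_action s (smult a p) f x = a * poly_action s p f x"
  by (induction p arbitrary: x) (simp_all add: poly_action_pCons algebra_simps)

lemma poly_action_mult: "poly_action s (p * q) f = poly_action s p (poly_action s q f)"
proof
  show "poly_action s (p * q) f x = poly_action s p (poly_action s q f) x" for x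
    by (induction p arbitrary: x)
       (simp_all add: poly_action_pCons poly_action_add poly_action_smult)
qed

lemma poly_action_zero_fun [simp]: "poly_action s p (\<lambda>_. 0) x = 0"
  by (simp add: poly_action_def)

lemma poly_action_sum_fun:
  "poly_action s p (\<lambda>x. \<Sum>i\<in>I. h i x) x = (\<Sum>i\<in>I. poly_action s p (h i) x)"
  by (simp add: poly_action_def sum_distrib_left sum.swap[of _ _ I])

lemma poly_action_multiple_zero:
  assumes "\<forall>x. poly_action s p f x = 0" and "p dvd q"
  shows "poly_action s q f x = 0"
proof -
  obtain r where "q = r * p"
    using assms(2) by (metis dvd_def mult.commute)
  moreover have "poly_action s p f = (\<lambda>_. 0)"
    using assms(1) by auto
  ultimately show ?thesis
    by (simp add: poly_action_mult)
qed

text \<open>The homogeneity class is a kernel of a power of a linear factor, written out by the binomial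
  theorem; the reversal \<open>k \<rightarrow> r - k\<close> matches the order of summation.\<close>

lemma homogeneity_class_iff_poly_action:
  "h \<in> homogeneity_class A \<mu> r \<longleftrightarrow>
     (\<forall>x. poly_action (\<lambda>y. matrix_inv A *v y) ([:-\<mu>, 1:] ^ r) h x = 0)"
proof -
  let ?s = "\<lambda>y. matrix_inv A *v y"
  have "poly_action ?s ([:-\<mu>, 1:] ^ r) h x
      = (\<Sum>k\<le>r. of_nat (r choose k) * (-\<mu>) ^ k * h ((?s ^^ (r - k)) x))" for x
  proof -
    have "poly_action ?s ([:-\<mu>, 1:] ^ r) h x
        = (\<Sum>k\<le>r. of_nat (r choose k) * (-\<mu>) ^ (r - k) * h ((?s ^^ k) x))"
      by (subst poly_action_eq_sum[of _ r])
         (auto intro!: sum.cong simp: coeff_linear_poly_power degree_linear_power)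
    also have "\<dots> = (\<Sum>k\<le>r. of_nat (r choose k) * (-\<mu>) ^ k * h ((?s ^^ (r - k)) x))"
      by (rule sum.reindex_bij_witness[of _ "\<lambda>k. r - k" "\<lambda>k. r - k"])
         (auto simp: binomial_symmetric[symmetric])
    finally show ?thesis .
  qed
  then show ?thesis
    by (simp add: homogeneity_class_def)
qed

lemma coprime_linear_power_prod:
  fixes \<mu> :: complex
  assumes "\<mu> \<notin> F"
  shows "coprime ([:-\<mu>, 1:] ^ m) (\<Prod>z\<in>F. [:-z, 1:] ^ r z)"
proof (rule prod_coprime_right)
  fix z assume "z \<in> F"
  then have "z - \<mu> \<noteq> 0"
    using assms by auto
  have "coprime [:-\<mu>, 1:] [:-z, 1:]"
  proof (rule coprimeI)
    fix d :: "complex poly" assume "d dvd [:-\<mu>, 1:]" "d dvd [:-z, 1:]"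
    then have "d dvd [:-\<mu>, 1:] - [:-z, 1:]"
      by (rule dvd_diff)
    then have "d dvd [:z - \<mu>:]"
      by simp
    moreover have "is_unit [:z - \<mu>:]"
      using \<open>z - \<mu> \<noteq> 0\<close> by (simp add: is_unit_const_poly_iff dvd_field_iff)
    ultimately show "is_unit d"
      by (rule dvd_unit_imp_unit)
  qed
  then show "coprime ([:-\<mu>, 1:] ^ m) ([:-z, 1:] ^ r z)"
    by simp
qed

text \<open>The Bezout identity that separates one generalized eigenspace from finitely many others.\<close>

lemma bezout_linear_power_prod:
  fixes \<mu> :: complex
  assumes "\<mu> \<notin> F"
  obtains u v where "u * [:-\<mu>, 1:] ^ m + v * (\<Prod>z\<in>F. [:-z, 1:] ^ r z) = 1"
  using bezout_coefficients_fst_snd coprime_linear_power_prod[OF assms]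
  by (metis coprime_iff_gcd_eq_1)

text \<open>The product \<open>b\<close> of the factors that belong to the other components kills all of them, hence it
  also kills \<open>h z\<close>, which is minus their sum.  Since \<open>[:-z, 1:] ^ r z\<close> kills \<open>h z\<close> too and is coprime to
  \<open>b\<close>, the Bezout combination \<open>1\<close> of the two kills \<open>h z\<close>.\<close>

lemma generalized_eigenfunctions_independent:
  assumes "finite F"
    and kill: "\<forall>z\<in>F. \<forall>x. poly_action s ([:-z, 1:] ^ r z) (h z) x = 0"
    and sum0: "\<forall>x. (\<Sum>z\<in>F. h z x) = 0"
    and "z \<in> F"
  shows "h z x = 0"
proof -
  define b where "b = (\<Prod>w\<in>F - {z}. [:-w, 1:] ^ r w)"
  obtain u v where uv: "u * [:-z, 1:] ^ r z + v * b = 1"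
    unfolding b_def by (rule bezout_linear_power_prod[of z "F - {z}"]) auto
  have others: "poly_action s b (h w) x = 0" if "w \<in> F - {z}" for w x
    by (rule poly_action_multiple_zero[of s "[:-w, 1:] ^ r w"])
       (use that kill \<open>finite F\<close> in \<open>auto simp: b_def intro!: dvd_prodI\<close>)
  have "poly_action s b (h z) x = 0" for x
  proof -
    have "0 = poly_action s b (\<lambda>x. \<Sum>w\<in>F. h w x) x"
      using sum0 by simp
    also have "\<dots> = poly_action s b (h z) x + (\<Sum>w\<in>F - {z}. poly_action s b (h w) x)"
      unfolding poly_action_sum_fun by (rule sum.remove[OF \<open>finite F\<close> \<open>z \<in> F\<close>])
    finally show ?thesis
      using others by simp
  qed
  then have "poly_action s (v * b) (h z) x = 0"
    by (intro poly_action_multiple_zero[of s b]) auto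
  moreover have "poly_action s (u * [:-z, 1:] ^ r z) (h z) x = 0"
    by (rule poly_action_multiple_zero[of s "[:-z, 1:] ^ r z"]) (use kill \<open>z \<in> F\<close> in auto)
  ultimately have "poly_action s 1 (h z) x = 0"
    unfolding uv[symmetric] by (simp add: poly_action_add)
  then show ?thesis
    by simp
qed

text \<open>One power of a linear factor is split off at a time: if \<open>u * a + v * b = 1\<close> and \<open>a * b\<close>
  kills \<open>f\<close>, then \<open>u * a\<close> maps \<open>f\<close>
  to a function killed by \<open>b\<close>, and \<open>v * b\<close> maps it to one killed by \<open>a\<close>.  Each component is obtained from
  \<open>f\<close> by a polynomial in the operator, so that it stays in every invariant subspace that contains \<open>f\<close>.\<close>

lemma primary_decomposition:
  assumes "finite F"
    and "\<forall>x. poly_action s (\<Prod>z\<in>F. [:-z, 1:] ^ r z) f x = 0"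
  shows "\<exists>g. (\<forall>x. f x = (\<Sum>z\<in>F. poly_action s (g z) f x)) \<and>
    (\<forall>z\<in>F. \<forall>x. poly_action s ([:-z, 1:] ^ r z) (poly_action s (g z) f) x = 0)"
  using assms
proof (induction F arbitrary: f rule: finite_induct)
  case empty
  then show ?case by simp
next
  case (insert \<mu> F)
  define a where "a = [:-\<mu>, 1:] ^ r \<mu>"
  define b where "b = (\<Prod>z\<in>F. [:-z, 1:] ^ r z)"
  obtain u v where uv: "u * a + v * b = 1"
    unfolding a_def b_def by (rule bezout_linear_power_prod[OF insert.hyps(2)])
  have ab: "\<forall>x. poly_action s (a * b) f x = 0"
    using insert.prems insert.hyps by (simp add: a_def b_def)
  define f1 where "f1 = poly_action s (u * a) f"
  have "\<forall>x. poly_action s b f1 x = 0"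
    unfolding f1_def poly_action_mult[symmetric]
    by (intro allI poly_action_multiple_zero[OF ab]) (simp add: ac_simps)
  then obtain g where g: "\<forall>x. f1 x = (\<Sum>z\<in>F. poly_action s (g z) f1 x)"
    "\<forall>z\<in>F. \<forall>x. poly_action s ([:-z, 1:] ^ r z) (poly_action s (g z) f1) x = 0"
    using insert.IH[of f1] unfolding b_def by blast
  define g' where "g' z = (if z = \<mu> then v * b else g z * (u * a))" for z
  have g'F: "poly_action s (g' z) f = poly_action s (g z) f1" if "z \<in> F" for z
    using that insert.hyps(2) by (auto simp: g'_def f1_def poly_action_mult)
  have "f x = (\<Sum>z\<in>insert \<mu> F. poly_action s (g' z) f x)" for x
  proof -
    have "f x = poly_action s (u * a + v * b) f x"
      by (simp add: uv)
    also have "\<dots> = f1 x + poly_action s (g' \<mu>) f x"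
      by (simp add: poly_action_add f1_def g'_def)
    also have "f1 x = (\<Sum>z\<in>F. poly_action s (g' z) f x)"
      using g(1) g'F by simp
    finally show ?thesis
      using insert.hyps by simp
  qed
  moreover have "poly_action s ([:-z, 1:] ^ r z) (poly_action s (g' z) f) x = 0"
    if "z \<in> insert \<mu> F" for z x
  proof (cases "z = \<mu>")
    case True
    then show ?thesis
      unfolding poly_action_mult[symmetric]
      by (intro poly_action_multiple_zero[OF ab]) (simp add: g'_def a_def ac_simps)
  next
    case False
    then show ?thesis
      using that g(2) g'F by simp
  qed
  ultimately show ?case
    by blast
qed

text \<open>The last nonzero function among \<open>f\<close>, \<open>(U - \<mu>) f\<close>, \<open>(U - \<mu>)\<^sup>2 f\<close>, \<open>\<dots>\<close> is an eigenfunction, where \<open>U\<close>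
  denotes composition with \<open>s\<close>.\<close>

lemma eigenfunction_of_generalized:
  assumes "\<forall>x. poly_action s ([:-\<mu>, 1:] ^ r) f x = 0" and "f x\<^sub>0 \<noteq> 0"
  shows "\<exists>p y. poly_action s p f y \<noteq> 0 \<and>
    (\<forall>x. poly_action s p f (s x) = \<mu> * poly_action s p f x)"
  using assms(1)
proof (induction r)
  case 0
  then show ?case using assms(2) by simp
next
  case (Suc r)
  show ?case
  proof (cases "\<forall>x. poly_action s ([:-\<mu>, 1:] ^ r) f x = 0")
    case True
    then show ?thesis by (rule Suc.IH)
  next
    case False
    then obtain y where y: "poly_action s ([:-\<mu>, 1:] ^ r) f y \<noteq> 0"
      by blast
    have "poly_action s ([:-\<mu>, 1:] ^ r) f (s x) = \<mu> * poly_action s ([:-\<mu>, 1:] ^ r) f x" for x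
    proof -
      have "poly_action s ([:-\<mu>, 1:] * [:-\<mu>, 1:] ^ r) f x = 0"
        using Suc.prems by simp
      then show ?thesis
        by (subst (asm) poly_action_mult) (simp add: poly_action_pCons)
    qed
    with y show ?thesis
      by blast
  qed
qed

text \<open>Over the complex numbers the annihilating polynomial splits into linear factors.  Only nonzero
  components are kept, so that each of them yields a genuine eigenfunction.\<close>

lemma annihilated_decomposition:
  assumes "p \<noteq> 0" and kill: "\<forall>x. poly_action s p f x = 0"
  obtains F g r where "finite F"
    and "\<And>x. f x = (\<Sum>z\<in>F. poly_action s (g z) f x)"
    and "\<And>z. z \<in> F \<Longrightarrow> r z \<ge> (1::nat)"
    and "\<And>z. z \<in> F \<Longrightarrow> \<exists>x. poly_action s (g z) f x \<noteq> 0"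
    and "\<And>z x. z \<in> F \<Longrightarrow> poly_action s ([:-z, 1:] ^ r z) (poly_action s (g z) f) x = 0"
proof -
  define Z where "Z = {z. poly p z = 0}"
  have "finite Z"
    unfolding Z_def using \<open>p \<noteq> 0\<close> by (rule poly_roots_finite)
  have "smult (lead_coeff p) (\<Prod>z\<in>Z. [:-z, 1:] ^ order z p) = p"
    unfolding Z_def by (rule complex_poly_decompose)
  then have "\<forall>x. poly_action s (\<Prod>z\<in>Z. [:-z, 1:] ^ order z p) f x = 0"
    using kill \<open>p \<noteq> 0\<close> poly_action_smult[of s "lead_coeff p" "\<Prod>z\<in>Z. [:-z, 1:] ^ order z p" f]
    by simp
  from primary_decomposition[OF \<open>finite Z\<close> this] obtain g where
    g: "\<And>x. f x = (\<Sum>z\<in>Z. poly_action s (g z) f x)"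
      "\<And>z x. z \<in> Z \<Longrightarrow> poly_action s ([:-z, 1:] ^ order z p) (poly_action s (g z) f) x = 0"
    by blast
  define F where "F = {z \<in> Z. \<exists>x. poly_action s (g z) f x \<noteq> 0}"
  show ?thesis
  proof (rule that[of F g "\<lambda>z. order z p"])
    show "f x = (\<Sum>z\<in>F. poly_action s (g z) f x)" for x
      unfolding g(1)[of x]
      by (rule sum.mono_neutral_right) (use \<open>finite Z\<close> in \<open>auto simp: F_def\<close>)
    show "order z p \<ge> 1" if "z \<in> F" for z
      using that \<open>p \<noteq> 0\<close> order_root[of p z] by (auto simp: F_def Z_def)
  qed (use \<open>finite Z\<close> g(2) in \<open>auto simp: F_def\<close>)
qed

section \<open>Linear dependence\<close>

text \<open>The vectors are indexed, so a repetition counts as a dependence; this spares the applications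
  below a proof that their vectors are distinct.\<close>

lemma (in vector_space) linearly_dependent_family:
  assumes "finite J" "finite B" "card B < card J" and w: "\<And>j. j \<in> J \<Longrightarrow> w j \<in> span B"
  shows "\<exists>u. (\<exists>j\<in>J. u j \<noteq> 0) \<and> (\<Sum>j\<in>J. scale (u j) (w j)) = 0"
proof (cases "inj_on w J")
  case True
  have "dependent (w ` J)"
  proof (rule ccontr)
    assume "\<not> dependent (w ` J)"
    then have "card (w ` J) \<le> card B"
      using independent_span_bound[OF \<open>finite B\<close>] w by blast
    then show False
      using assms(3) card_image[OF True] by simp
  qed
  then obtain u where u: "\<exists>v\<in>w ` J. u v \<noteq> 0" "(\<Sum>v\<in>w ` J. scale (u v) v) = 0"
    using dependent_finite[of "w ` J"] \<open>finite J\<close> by auto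
  then show ?thesis
    by (intro exI[of _ "u \<circ> w"]) (auto simp: sum.reindex[OF True])
next
  case False
  then obtain i j where ij: "i \<in> J" "j \<in> J" "i \<noteq> j" "w i = w j"
    by (auto simp: inj_on_def)
  define u :: "'c \<Rightarrow> 'a" where "u k = (if k = i then 1 else if k = j then -1 else 0)" for k
  have "(\<Sum>k\<in>J. scale (u k) (w k)) = (\<Sum>k\<in>{i, j}. scale (u k) (w k))"
    by (rule sum.mono_neutral_right) (use ij \<open>finite J\<close> in \<open>auto simp: u_def\<close>)
  also have "\<dots> = 0"
    using ij by (simp add: u_def)
  finally show ?thesis
    using ij(1) by (intro exI[of _ u]) (auto simp: u_def)
qed

interpretation cfun: vector_space "\<lambda>(a::complex) (f::'a \<Rightarrow> complex) x. a * f x"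
  by unfold_locales (auto simp: fun_eq_iff algebra_simps)

lemma sum_fun_apply: "(\<Sum>i\<in>I. h i) x = (\<Sum>i\<in>I. (h i x :: complex))"
  by (induction I rule: infinite_finite_induct) auto

text \<open>If all iterates of \<open>f\<close> lie in the span of \<open>N\<close> functions, then the first \<open>N + 1\<close> of them are linearly
  dependent, and a dependence relation is the coefficient list of an annihilating polynomial.\<close>

lemma annihilating_poly_exists:
  assumes "finite B" and "\<And>k. (\<lambda>x. f ((s ^^ k) x)) \<in> cfun.span B"
  shows "\<exists>p. p \<noteq> 0 \<and> (\<forall>x. poly_action s p f x = 0)"
proof -
  define N where "N = card B"
  obtain u where u: "\<exists>k\<le>N. u k \<noteq> 0" "(\<Sum>k\<le>N. (\<lambda>x. u k * f ((s ^^ k) x))) = 0"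
    using cfun.linearly_dependent_family[of "{..N}" B "\<lambda>k x. f ((s ^^ k) x)"] assms
    by (auto simp: N_def)
  define p where "p = (\<Sum>k\<le>N. monom (u k) k)"
  have coeff_p: "coeff p k = (if k \<le> N then u k else 0)" for k
    by (auto simp: p_def coeff_sum)
  have "degree p \<le> N"
    by (rule degree_le) (simp add: coeff_p)
  then have "poly_action s p f x = 0" for x
    using fun_cong[OF u(2), of x]
    by (simp add: poly_action_eq_sum coeff_p sum_fun_apply)
  moreover have "p \<noteq> 0"
    using u(1) coeff_p by (metis coeff_0)
  ultimately show ?thesis
    by blast
qed

text \<open>The bilinear pairing with the left eigenvector \<open>y\<close> vanishes on the image of \<open>M - \<mu>\<close>, so the image
  lies in a hyperplane, which is spanned by one vector fewer than there are columns.  The columns are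
  therefore dependent, and the
  coefficients of a dependence form a right eigenvector.\<close>

lemma left_eigenvector_imp_eigenvalue:
  assumes "finite I" and "i\<^sub>0 \<in> I" "y i\<^sub>0 \<noteq> 0"
    and left: "\<forall>j\<in>I. (\<Sum>i\<in>I. y i * M i j) = \<mu> * y j"
  shows "\<mu> \<in> eigenvalues_on I M"
proof -
  \<comment> \<open>The vectors \<open>b i\<close> with \<open>i \<noteq> i\<^sub>0\<close> form a basis of the hyperplane where the pairing with \<open>y\<close> vanishes,
    and \<open>w j\<close> is the
    column \<open>j\<close> of \<open>M - \<mu>\<close>, extended by \<open>0\<close>.\<close>
  define e where "e i k = (if k = i then 1 else 0 :: complex)" for i k :: 'a
  define b where "b i k = e i k - y i / y i\<^sub>0 * e i\<^sub>0 k" for i k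
  define B where "B = b ` (I - {i\<^sub>0})"
  define w where "w j i = (if i \<in> I then M i j - \<mu> * e j i else 0)" for j i
  have "card B < card I"
    unfolding B_def using card_image_le[of "I - {i\<^sub>0}" b] assms(1,2)
    by (metis card_Diff1_less finite_Diff le_less_trans)
  have "w j \<in> cfun.span B" if "j \<in> I" for j
  proof -
    have "w j = (\<Sum>i\<in>I - {i\<^sub>0}. (\<lambda>k. w j i * b i k))"
    proof
      fix k
      have orth: "(\<Sum>i\<in>I. y i * w j i) = 0"
      proof -
        have "(\<Sum>i\<in>I. y i * w j i) = (\<Sum>i\<in>I. y i * M i j - (if i = j then \<mu> * y j else 0))"
          by (rule sum.cong) (auto simp: w_def e_def algebra_simps)
        then show ?thesis
          using left that assms(1) by (simp add: sum_subtractf)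
      qed
      then have i0: "(\<Sum>i\<in>I - {i\<^sub>0}. y i * w j i) = - y i\<^sub>0 * w j i\<^sub>0"
        using sum.remove[OF assms(1,2), of "\<lambda>i. y i * w j i"] by (simp add: add_eq_0_iff)
      have "(\<Sum>i\<in>I - {i\<^sub>0}. (\<lambda>k. w j i * b i k)) k
          = (\<Sum>i\<in>I - {i\<^sub>0}. w j i * e i k) - (\<Sum>i\<in>I - {i\<^sub>0}. y i * w j i) / y i\<^sub>0 * e i\<^sub>0 k"
        by (simp add: sum_fun_apply b_def algebra_simps sum_subtractf sum_distrib_left sum_divide_distrib)
      also have "\<dots> = (\<Sum>i\<in>I - {i\<^sub>0}. w j i * e i k) + w j i\<^sub>0 * e i\<^sub>0 k"
        using i0 assms(3) by simp
      also have "\<dots> = (\<Sum>i\<in>I. w j i * e i k)"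
        by (simp add: sum.remove[OF assms(1,2)])
      also have "\<dots> = w j k"
        using assms(1) by (simp add: e_def w_def if_distrib cong: if_cong)
      finally show "w j k = (\<Sum>i\<in>I - {i\<^sub>0}. (\<lambda>k. w j i * b i k)) k" ..
    qed
    also have "\<dots> \<in> cfun.span B"
      by (intro cfun.span_sum cfun.span_scale cfun.span_base) (auto simp: B_def)
    finally show ?thesis .
  qed
  then obtain v where v: "\<exists>j\<in>I. v j \<noteq> 0" "(\<Sum>j\<in>I. (\<lambda>x. v j * w j x)) = 0"
    using cfun.linearly_dependent_family[of I B w] \<open>finite I\<close> \<open>card B < card I\<close>
    by (auto simp: B_def)
  have "(\<Sum>j\<in>I. M i j * v j) = \<mu> * v i" if "i \<in> I" for i
  proof -
    have "0 = (\<Sum>j\<in>I. v j * w j i)"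
      using fun_cong[OF v(2), of i] by (simp add: sum_fun_apply)
    also have "\<dots> = (\<Sum>j\<in>I. M i j * v j) - (\<Sum>j\<in>I. \<mu> * (v j * e j i))"
      using that by (simp add: w_def algebra_simps sum_subtractf)
    also have "(\<Sum>j\<in>I. \<mu> * (v j * e j i)) = \<mu> * v i"
      using that assms(1) by (simp add: e_def if_distrib cong: if_cong)
    finally show ?thesis by simp
  qed
  with v(1) show ?thesis
    unfolding eigenvalues_on_def by blast
qed

section \<open>Polynomials under linear substitutions\<close>

text \<open>The exponents range over all multi-indices whose total degree belongs to the given set: with a
  singleton these are the homogeneous polynomials of that degree, and with \<open>{..<m}\<close> the polynomials of
  degree less than \<open>m\<close>.\<close>

definition monomial_span :: "nat set \<Rightarrow> (real ^ 'd::finite \<Rightarrow> complex) set" where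
  "monomial_span S = cfun.span (monomial_fun ` {\<alpha>. (\<Sum>i\<in>UNIV. \<alpha> i) \<in> S})"

lemma subspace_monomial_span: "cfun.subspace (monomial_span S)"
  by (simp add: monomial_span_def)

lemma monomial_span_mono: "S \<subseteq> T \<Longrightarrow> monomial_span S \<subseteq> monomial_span T"
  unfolding monomial_span_def by (rule cfun.span_mono) auto

lemma monomial_fun_in_span: "monomial_fun \<alpha> \<in> monomial_span {\<Sum>i\<in>UNIV. \<alpha> i}"
  unfolding monomial_span_def by (intro cfun.span_base) auto

lemma monomial_fun_mult:
  "monomial_fun \<alpha> x * monomial_fun \<beta> x = monomial_fun (\<lambda>i. \<alpha> i + \<beta> i) x"
  by (simp add: monomial_fun_def power_add prod.distrib)

lemma monomial_span_mult:
  assumes "f \<in> monomial_span {a}" "g \<in> monomial_span {b}"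
  shows "(\<lambda>x. f x * g x) \<in> monomial_span {a + b}"
proof -
  let ?V = "monomial_span {a + b} :: (real ^ 'a \<Rightarrow> complex) set"
  have sub: "cfun.subspace {h. (\<lambda>x. k x * h x) \<in> ?V}" for k
    using subspace_monomial_span[of "{a + b}"]
    unfolding cfun.subspace_def plus_fun_def zero_fun_def
    by (auto simp: distrib_left mult.left_commute)
  have "(\<lambda>x. monomial_fun \<alpha> x * g x) \<in> ?V" if "(\<Sum>i\<in>UNIV. \<alpha> i) = a" for \<alpha>
    by (rule cfun.span_induct[OF assms(2)[unfolded monomial_span_def] sub])
       (use that monomial_fun_in_span[of "\<lambda>i. \<alpha> i + \<beta> i" for \<beta>] in
         \<open>force simp: monomial_fun_mult sum.distrib\<close>)
  then have base: "(\<lambda>x. g x * monomial_fun \<alpha> x) \<in> ?V" if "(\<Sum>i\<in>UNIV. \<alpha> i) = a" for \<alpha>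
    using that by (simp add: mult.commute)
  have "(\<lambda>x. g x * f x) \<in> ?V"
    by (rule cfun.span_induct[OF assms(1)[unfolded monomial_span_def] sub]) (use base in auto)
  then show ?thesis
    by (simp add: mult.commute)
qed

lemma one_in_monomial_span: "(\<lambda>_. 1) \<in> monomial_span {0}"
  using monomial_fun_in_span[of "\<lambda>_. 0"] by (simp add: monomial_fun_def[abs_def])

lemma monomial_span_power:
  "f \<in> monomial_span {a} \<Longrightarrow> (\<lambda>x. f x ^ n) \<in> monomial_span {n * a}"
  by (induction n) (simp_all add: one_in_monomial_span monomial_span_mult)

lemma monomial_span_prod:
  assumes "\<And>i. i \<in> I \<Longrightarrow> f i \<in> monomial_span {a i}"
  shows "(\<lambda>x. \<Prod>i\<in>I. f i x) \<in> monomial_span {\<Sum>i\<in>I. a i}"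
  using assms
  by (induction I rule: infinite_finite_induct)
     (simp_all add: one_in_monomial_span monomial_span_mult)

lemma coordinate_in_monomial_span:
  "(\<lambda>x::real ^ 'd::finite. complex_of_real (x $ j)) \<in> monomial_span {1}"
proof -
  have "(\<lambda>x::real ^ 'd. complex_of_real (x $ j)) = monomial_fun (\<lambda>i. if i = j then 1 else 0)"
    by (auto simp: monomial_fun_def fun_eq_iff if_distrib[of "\<lambda>n. _ ^ n"] cong: if_cong)
  then show ?thesis
    using monomial_fun_in_span[of "\<lambda>i::'d. if i = j then 1 else 0"] by simp
qed

lemma linear_form_in_monomial_span:
  "(\<lambda>x::real ^ 'd::finite. complex_of_real ((B *v x) $ i)) \<in> monomial_span {1}"
proof -
  have "(\<lambda>x::real ^ 'd. complex_of_real ((B *v x) $ i))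
      = (\<Sum>j\<in>UNIV. (\<lambda>x. complex_of_real (B $ i $ j) * complex_of_real (x $ j)))"
    by (auto simp: fun_eq_iff sum_fun_apply matrix_vector_mult_def)
  also have "\<dots> \<in> monomial_span {1}"
    by (intro cfun.subspace_sum[OF subspace_monomial_span]
        cfun.subspace_scale[OF subspace_monomial_span] coordinate_in_monomial_span)
  finally show ?thesis .
qed

text \<open>A monomial turns into a product of linear forms, with the same number of factors.  Homogeneous
  pieces are used here because their degrees add exactly under multiplication.\<close>

lemma monomial_span_linear_substitution:
  assumes "q \<in> monomial_span S"
  shows "(\<lambda>x::real ^ 'd::finite. q (B *v x)) \<in> monomial_span S"
proof -
  have sub: "cfun.subspace {q. (\<lambda>x::real ^ 'd. q (B *v x)) \<in> monomial_span S}"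
    using subspace_monomial_span[of S]
    unfolding cfun.subspace_def plus_fun_def zero_fun_def by auto
  have base: "(\<lambda>x::real ^ 'd. monomial_fun \<alpha> (B *v x)) \<in> monomial_span S"
    if "(\<Sum>i\<in>UNIV. \<alpha> i) \<in> S" for \<alpha>
  proof -
    have "(\<lambda>x::real ^ 'd. \<Prod>i\<in>UNIV. complex_of_real ((B *v x) $ i) ^ \<alpha> i)
        \<in> monomial_span {\<Sum>i\<in>UNIV. \<alpha> i * 1}"
      by (intro monomial_span_prod monomial_span_power linear_form_in_monomial_span)
    then show ?thesis
      using that monomial_span_mono[of "{\<Sum>i\<in>UNIV. \<alpha> i}" S]
      by (auto simp: monomial_fun_def)
  qed
  show ?thesis
    by (rule cfun.span_induct[OF assms[unfolded monomial_span_def] sub]) (use base in auto)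
qed

lemma finite_multi_indices: "finite {\<alpha> :: 'd::finite \<Rightarrow> nat. (\<Sum>i\<in>UNIV. \<alpha> i) < m}"
proof (rule finite_subset)
  have "\<alpha> i < m" if "(\<Sum>i\<in>UNIV. \<alpha> i) < m" for \<alpha> :: "'d \<Rightarrow> nat" and i
    using member_le_sum[of i UNIV \<alpha>] that by simp
  then show "{\<alpha> :: 'd \<Rightarrow> nat. (\<Sum>i\<in>UNIV. \<alpha> i) < m} \<subseteq> PiE UNIV (\<lambda>_. {..<m})"
    by (auto simp: PiE_UNIV_domain)
  show "finite (PiE (UNIV :: 'd set) (\<lambda>_. {..<m}))"
    by (intro finite_PiE) auto
qed

lemma poly_degree_less_iff_monomial_span:
  "poly_degree_less m q \<longleftrightarrow> q \<in> monomial_span {..<m}"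
proof
  assume "poly_degree_less m q"
  then obtain a where "q = (\<lambda>x. \<Sum>\<alpha> | (\<Sum>i\<in>UNIV. \<alpha> i) < m. a \<alpha> * monomial_fun \<alpha> x)"
    by (auto simp: poly_degree_less_def)
  then have "q = (\<Sum>\<alpha> | (\<Sum>i\<in>UNIV. \<alpha> i) < m. (\<lambda>x. a \<alpha> * monomial_fun \<alpha> x))"
    by (auto simp: fun_eq_iff sum_fun_apply)
  also have "\<dots> \<in> monomial_span {..<m}"
    unfolding monomial_span_def
    by (intro cfun.span_sum cfun.span_scale cfun.span_base) auto
  finally show "q \<in> monomial_span {..<m}" .
next
  assume "q \<in> monomial_span {..<m}"
  then show "poly_degree_less m q"
    unfolding monomial_span_def
  proof (induction rule: cfun.span_induct_alt)
    case base
    show ?case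
      unfolding poly_degree_less_def by (intro exI[of _ "\<lambda>_. 0"]) auto
  next
    case (step b f g)
    then obtain \<beta> a where \<beta>: "f = monomial_fun \<beta>" "(\<Sum>i\<in>UNIV. \<beta> i) < m"
      and a: "g = (\<lambda>x. \<Sum>\<alpha> | (\<Sum>i\<in>UNIV. \<alpha> i) < m. a \<alpha> * monomial_fun \<alpha> x)"
      by (auto simp: poly_degree_less_def)
    define a' where "a' \<alpha> = (if \<alpha> = \<beta> then b else 0) + a \<alpha>" for \<alpha>
    have "(\<Sum>\<alpha> | (\<Sum>i\<in>UNIV. \<alpha> i) < m. a' \<alpha> * monomial_fun \<alpha> x)
        = (\<Sum>\<alpha> | (\<Sum>i\<in>UNIV. \<alpha> i) < m.
             (if \<alpha> = \<beta> then b * monomial_fun \<beta> x else 0) + a \<alpha> * monomial_fun \<alpha> x)" for x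
      by (rule sum.cong) (auto simp: a'_def distrib_right)
    then have "(\<lambda>x. b * f x) + g = (\<lambda>x. \<Sum>\<alpha> | (\<Sum>i\<in>UNIV. \<alpha> i) < m. a' \<alpha> * monomial_fun \<alpha> x)"
      using \<beta> by (auto simp: a sum.distrib finite_multi_indices)
    then show ?case
      unfolding poly_degree_less_def by blast
  qed
qed

lemma poly_degree_less_poly_action:
  assumes "poly_degree_less m q"
  shows "poly_degree_less m (poly_action (\<lambda>x. B *v x) p q)"
proof -
  let ?s = "\<lambda>x. B *v x"
  have iter: "(\<lambda>x. q ((?s ^^ k) x)) \<in> monomial_span {..<m}" for k
  proof (induction k)
    case (Suc k)
    then show ?case
      using monomial_span_linear_substitution[of "\<lambda>x. q ((?s ^^ k) x)" "{..<m}" B]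
      by (simp add: funpow_swap1)
  qed (use assms in \<open>simp add: poly_degree_less_iff_monomial_span\<close>)
  have "poly_action ?s p q = (\<Sum>k\<le>degree p. (\<lambda>x. coeff p k * q ((?s ^^ k) x)))"
    by (auto simp: poly_action_def sum_fun_apply)
  also have "\<dots> \<in> monomial_span {..<m}"
    by (intro cfun.subspace_sum[OF subspace_monomial_span]
        cfun.subspace_scale[OF subspace_monomial_span] iter)
  finally show ?thesis
    by (simp add: poly_degree_less_iff_monomial_span)
qed

lemma poly_degree_less_annihilated:
  fixes q :: "real ^ 'd::finite \<Rightarrow> complex"
  assumes "poly_degree_less m q"
  shows "\<exists>p. p \<noteq> 0 \<and> (\<forall>x. poly_action (\<lambda>x. B *v x) p q x = 0)"
proof (rule annihilating_poly_exists)
  show "finite (monomial_fun ` {\<alpha> :: 'd \<Rightarrow> nat. (\<Sum>i\<in>UNIV. \<alpha> i) \<in> {..<m}})"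
    by (simp add: finite_multi_indices)
  fix k
  \<comment> \<open>As the action of a monomial, the iterate is covered by the invariance of the space.\<close>
  have "poly_action (\<lambda>x. B *v x) (monom 1 k) q = (\<lambda>x. q (((\<lambda>x. B *v x) ^^ k) x))"
    by (simp add: fun_eq_iff poly_action_def degree_monom_eq if_distrib[of "\<lambda>c. c * _"] cong: if_cong)
  then show "(\<lambda>x. q (((\<lambda>x. B *v x) ^^ k) x))
      \<in> cfun.span (monomial_fun ` {\<alpha> :: 'd \<Rightarrow> nat. (\<Sum>i\<in>UNIV. \<alpha> i) \<in> {..<m}})"
    using poly_degree_less_poly_action[OF assms, of B "monom 1 k"]
    by (simp add: poly_degree_less_iff_monomial_span monomial_span_def)
qed

section \<open>Lattices and dilation matrices\<close>

lemma matrix_inv_mult_vec: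
  assumes "invertible A"
  shows "matrix_inv A *v (A *v x) = x" and "A *v (matrix_inv A *v x) = x"
proof -
  have "A ** matrix_inv A = mat 1 \<and> matrix_inv A ** A = mat 1"
    using assms unfolding matrix_inv_def invertible_def by (rule someI_ex)
  then show "matrix_inv A *v (A *v x) = x" and "A *v (matrix_inv A *v x) = x"
    by (simp_all add: matrix_vector_mul_assoc)
qed

lemma lattice_diff:
  assumes "is_lattice \<Gamma>" "x \<in> \<Gamma>" "y \<in> \<Gamma>"
  shows "x - y \<in> \<Gamma>"
proof -
  obtain B :: "real ^ 'a ^ 'a" where B: "\<Gamma> = (\<lambda>z. B *v z) ` {z. \<forall>i. z $ i \<in> \<int>}"
    using assms(1) unfolding is_lattice_def by blast
  obtain u v where "x = B *v u" "y = B *v v" "\<forall>i. u $ i \<in> \<int>" "\<forall>i. v $ i \<in> \<int>"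
    using assms(2,3) B by auto
  then show ?thesis
    unfolding B by (intro image_eqI[of _ _ "u - v"]) (auto simp: matrix_vector_mult_diff_distrib)
qed

lemma lattice_uminus_iff:
  assumes "is_lattice \<Gamma>"
  shows "- x \<in> \<Gamma> \<longleftrightarrow> x \<in> \<Gamma>"
proof -
  have "- y \<in> \<Gamma>" if "y \<in> \<Gamma>" for y
    using lattice_diff[OF assms lattice_diff[OF assms that that] that] by simp
  from this[of x] this[of "- x"] show ?thesis
    by auto
qed

text \<open>In coordinates with respect to a lattice basis, the points become integer vectors with
  bounded entries.\<close>

lemma finite_lattice_Int_bounded:
  fixes \<Gamma> :: "(real ^ 'd::finite) set"
  assumes "is_lattice \<Gamma>" "bounded S"
  shows "finite (\<Gamma> \<inter> S)"
proof -
  obtain B :: "real ^ 'd ^ 'd" where B: "invertible B"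
    "\<Gamma> = (\<lambda>z. B *v z) ` {z. \<forall>i. z $ i \<in> \<int>}"
    using assms(1) unfolding is_lattice_def by blast
  have "bounded ((\<lambda>x. matrix_inv B *v x) ` S)"
    by (rule bounded_linear_image[OF assms(2)]) (rule matrix_vector_mul_bounded_linear)
  then obtain b where b: "\<And>x. x \<in> S \<Longrightarrow> norm (matrix_inv B *v x) \<le> b"
    unfolding bounded_iff by auto
  define Z where "Z = {t \<in> \<int>. \<bar>t\<bar> \<le> b}"
  have "\<Gamma> \<inter> S \<subseteq> (\<lambda>f. B *v vec_lambda f) ` PiE UNIV (\<lambda>_. Z)"
  proof
    fix x assume "x \<in> \<Gamma> \<inter> S"
    then obtain z where z: "x = B *v z" "\<forall>i. z $ i \<in> \<int>" and "x \<in> S"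
      using B(2) by auto
    have "matrix_inv B *v x = z"
      by (simp add: z matrix_inv_mult_vec[OF B(1)])
    then have "\<bar>z $ i\<bar> \<le> b" for i
      using b[OF \<open>x \<in> S\<close>] component_le_norm_cart[of z i] by simp
    then show "x \<in> (\<lambda>f. B *v vec_lambda f) ` PiE UNIV (\<lambda>_. Z)"
      using z by (intro image_eqI[of _ _ "\<lambda>i. z $ i"]) (auto simp: Z_def)
  qed
  moreover have "finite (PiE (UNIV :: 'd set) (\<lambda>_. Z))"
    using finite_abs_int_segment[of b] by (intro finite_PiE) (auto simp: Z_def)
  ultimately show ?thesis
    by (meson finite_imageI finite_subset)
qed

text \<open>This makes every expansion in the translates of a compactly supported function a finite sum at
  each point, so that sums over the lattice may be rearranged freely.\<close>

lemma finite_lattice_translates_nonzero: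
  assumes "is_lattice \<Gamma>" "compactly_supported \<phi>"
  shows "finite {k \<in> \<Gamma>. \<phi> (x + k) \<noteq> 0}"
proof -
  have "bounded {y. \<phi> y \<noteq> 0}"
    using assms(2) unfolding compactly_supported_def
    by (meson bounded_subset closure_subset compact_imp_bounded)
  then have "bounded ((\<lambda>y. - x + y) ` {y. \<phi> y \<noteq> 0})"
    by (rule bounded_translation)
  then have "finite (\<Gamma> \<inter> (\<lambda>y. - x + y) ` {y. \<phi> y \<noteq> 0})"
    by (rule finite_lattice_Int_bounded[OF assms(1)])
  moreover have "{k \<in> \<Gamma>. \<phi> (x + k) \<noteq> 0} \<subseteq> \<Gamma> \<inter> (\<lambda>y. - x + y) ` {y. \<phi> y \<noteq> 0}"
  proof
    fix k assume "k \<in> {k \<in> \<Gamma>. \<phi> (x + k) \<noteq> 0}"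
    then show "k \<in> \<Gamma> \<inter> (\<lambda>y. - x + y) ` {y. \<phi> y \<noteq> 0}"
      by (auto intro!: image_eqI[of _ _ "x + k"])
  qed
  ultimately show ?thesis
    by (rule rev_finite_subset)
qed

text \<open>A kernel vector, complexified, would be an eigenvector for the eigenvalue \<open>0\<close>, whose modulus
  is not greater than \<open>1\<close>.\<close>

lemma dilation_matrix_invertible:
  fixes A :: "real ^ 'd::finite ^ 'd"
  assumes "is_dilation_matrix \<Gamma> A"
  shows "invertible A"
proof -
  have "x = 0" if "A *v x = 0" for x
  proof (rule ccontr)
    assume "x \<noteq> 0"
    define v :: "complex ^ 'd" where "v = (\<chi> i. complex_of_real (x $ i))"
    have "v \<noteq> 0"
      using \<open>x \<noteq> 0\<close> by (auto simp: v_def vec_eq_iff)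
    moreover have "(\<chi> i j. complex_of_real (A $ i $ j)) *v v = 0 *s v"
      using that by (simp add: v_def vec_eq_iff matrix_vector_mult_def flip: of_real_mult of_real_sum)
    ultimately have "cmod 0 > 1"
      using assms unfolding is_dilation_matrix_def by blast
    then show False by simp
  qed
  then show ?thesis
    using invertible_left_inverse matrix_left_invertible_ker by blast
qed

section \<open>Refinement acts on coefficients\<close>

text \<open>The row vector \<open>y T\<close> for the bi-infinite matrix \<open>T = [c\<^bsub>Ai-j\<^esub>]\<close>.  Restricting
  \<open>A k - j\<close> to \<open>\<Lambda>\<close> treats \<open>c\<close> as zero elsewhere and, for finite \<open>\<Lambda>\<close> and invertible \<open>A\<close>, leaves finitely many
  terms.\<close>

definition refinement_coeffs ::
  "(real ^ 'd) set \<Rightarrow> real ^ 'd ^ 'd \<Rightarrow> (real ^ 'd) set \<Rightarrow> (real ^ 'd \<Rightarrow> complex) \<Rightarrow>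
    (real ^ 'd \<Rightarrow> complex) \<Rightarrow> real ^ 'd \<Rightarrow> complex" where
  "refinement_coeffs \<Gamma> A \<Lambda> c y j = (\<Sum>k | k \<in> \<Gamma> \<and> A *v k - j \<in> \<Lambda>. y k * c (A *v k - j))"

text \<open>Substituting the refinement equation into \<open>f (A\<^sup>-\<^sup>1 x) = (\<Sum>k. y k * \<phi> (A\<^sup>-\<^sup>1 x + k))\<close> produces the terms
  \<open>y k * c l * \<phi> (x + A k - l)\<close>; collecting those with \<open>A k - l = j\<close> gives the coefficient of
  \<open>\<phi> (x + j)\<close>.  So dilation of a function is multiplication of its coefficient row by
  the matrix \<open>T = [c\<^bsub>Ai-j\<^esub>]\<close>.\<close>

lemma expansion_of_dilated:
  fixes \<Gamma> \<Lambda> :: "(real ^ 'd::finite) set"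
  assumes lattice: "is_lattice \<Gamma>" and A: "invertible A" "(\<lambda>x. A *v x) ` \<Gamma> \<subseteq> \<Gamma>"
    and Lambda: "finite \<Lambda>" "\<Lambda> \<subseteq> \<Gamma>"
    and supp: "compactly_supported \<phi>"
    and refinement: "\<forall>x. \<phi> x = (\<Sum>k\<in>\<Lambda>. c k * \<phi> (A *v x - k))"
    and f: "\<forall>x. ((\<lambda>k. y k * \<phi> (x + k)) has_sum f x) \<Gamma>"
  shows "((\<lambda>j. refinement_coeffs \<Gamma> A \<Lambda> c y j * \<phi> (x + j)) has_sum f (matrix_inv A *v x)) \<Gamma>"
proof -
  define w where "w = matrix_inv A *v x"
  have Aw: "A *v w = x"
    by (simp add: w_def matrix_inv_mult_vec[OF A(1)])
  \<comment> \<open>All nonzero terms of the double sum, at the fixed point \<open>x\<close>, have \<open>k \<in> K\<close> and \<open>j \<in> J\<close>.\<close>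
  define J where "J = {j \<in> \<Gamma>. \<phi> (x + j) \<noteq> 0}"
  have "finite J"
    unfolding J_def by (rule finite_lattice_translates_nonzero[OF lattice supp])
  define K where "K = {k \<in> \<Gamma>. \<exists>j\<in>J. A *v k - j \<in> \<Lambda>}"
  have "K \<subseteq> (\<lambda>(j, l). matrix_inv A *v (j + l)) ` (J \<times> \<Lambda>)"
  proof
    fix k assume "k \<in> K"
    then obtain j where "j \<in> J" "A *v k - j \<in> \<Lambda>"
      by (auto simp: K_def)
    moreover have "k = matrix_inv A *v (j + (A *v k - j))"
      by (simp add: matrix_inv_mult_vec[OF A(1)])
    ultimately show "k \<in> (\<lambda>(j, l). matrix_inv A *v (j + l)) ` (J \<times> \<Lambda>)"
      by (intro image_eqI[of _ _ "(j, A *v k - j)"]) auto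
  qed
  then have "finite K"
    using \<open>finite J\<close> Lambda(1) by (meson finite_SigmaI finite_imageI finite_subset)
  define c' where "c' m = (if m \<in> \<Lambda> then c m else 0)" for m
  have inner: "\<phi> (w + k) = (\<Sum>j\<in>J. c' (A *v k - j) * \<phi> (x + j))" if "k \<in> \<Gamma>" for k
  proof -
    have mem: "A *v k - m \<in> \<Gamma>" if "m \<in> \<Gamma>" for m
      using lattice_diff[OF lattice _ that] A(2) \<open>k \<in> \<Gamma>\<close> by auto
    have "\<phi> (w + k) = (\<Sum>l\<in>\<Lambda>. c l * \<phi> (x + (A *v k - l)))"
      by (subst refinement[rule_format]) (simp add: matrix_vector_right_distrib Aw add_diff_eq)
    also have "\<dots> = (\<Sum>l | l \<in> \<Lambda> \<and> A *v k - l \<in> J. c l * \<phi> (x + (A *v k - l)))"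
      by (rule sum.mono_neutral_right) (use Lambda mem in \<open>auto simp: J_def\<close>)
    also have "\<dots> = (\<Sum>j | j \<in> J \<and> A *v k - j \<in> \<Lambda>. c' (A *v k - j) * \<phi> (x + j))"
      by (rule sum.reindex_bij_witness[of _ "\<lambda>j. A *v k - j" "\<lambda>l. A *v k - l"])
         (auto simp: c'_def)
    also have "\<dots> = (\<Sum>j\<in>J. c' (A *v k - j) * \<phi> (x + j))"
      by (rule sum.mono_neutral_left) (use \<open>finite J\<close> in \<open>auto simp: c'_def\<close>)
    finally show ?thesis .
  qed
  have outer: "refinement_coeffs \<Gamma> A \<Lambda> c y j = (\<Sum>k\<in>K. y k * c' (A *v k - j))" if "j \<in> J" for j
    unfolding refinement_coeffs_def
    by (rule sum.mono_neutral_cong_left) (use that \<open>finite K\<close> in \<open>auto simp: K_def c'_def\<close>)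
  have "((\<lambda>k. y k * \<phi> (w + k)) has_sum (\<Sum>k\<in>K. y k * \<phi> (w + k))) \<Gamma>"
  proof (rule has_sum_finite_neutralI[OF \<open>finite K\<close>])
    show "K \<subseteq> \<Gamma>"
      by (auto simp: K_def)
    show "y k * \<phi> (w + k) = 0" if "k \<in> \<Gamma> - K" for k
    proof -
      have "c' (A *v k - j) = 0" if "j \<in> J" for j
        using \<open>k \<in> \<Gamma> - K\<close> that by (auto simp: K_def c'_def)
      then show ?thesis
        using that by (simp add: inner)
    qed
  qed simp
  then have "f w = (\<Sum>k\<in>K. y k * \<phi> (w + k))"
    using f has_sum_unique by blast
  also have "\<dots> = (\<Sum>k\<in>K. \<Sum>j\<in>J. y k * c' (A *v k - j) * \<phi> (x + j))"
    by (rule sum.cong) (auto simp: inner K_def sum_distrib_left mult.assoc)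
  also have "\<dots> = (\<Sum>j\<in>J. \<Sum>k\<in>K. y k * c' (A *v k - j) * \<phi> (x + j))"
    by (rule sum.swap)
  also have "\<dots> = (\<Sum>j\<in>J. refinement_coeffs \<Gamma> A \<Lambda> c y j * \<phi> (x + j))"
    by (rule sum.cong) (auto simp: outer sum_distrib_right)
  finally show ?thesis
    unfolding w_def[symmetric]
    by (intro has_sum_finite_neutralI[OF \<open>finite J\<close>]) (auto simp: J_def)
qed

text \<open>If \<open>c (A k - j)\<close> does not vanish for lattice points \<open>k\<close> and \<open>j\<close>, then \<open>k\<close> lies in
  \<open>A\<^sup>-\<^sup>1 (j + \<Lambda>)\<close>.  Hence a set \<open>W\<close> that contains the
  lattice points of \<open>w\<^sub>\<Lambda> (S)\<close> carries all the terms in the columns \<open>j \<in> S\<close>.  With \<open>W = S\<close> admissible, the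
  finite block of \<open>T\<close> on \<open>S\<close> acts on restricted rows; with \<open>W\<close> smaller than \<open>S\<close>, a row that vanishes on
  \<open>W\<close> has an image that vanishes on \<open>S\<close>.\<close>

lemma refinement_coeffs_eq_sum:
  assumes "invertible A" "(\<lambda>x. A *v x) ` \<Gamma> \<subseteq> \<Gamma>" "is_lattice \<Gamma>" "\<forall>k\<in>\<Gamma> - \<Lambda>. c k = 0"
    and sub: "w_map A \<Lambda> S \<inter> \<Gamma> \<subseteq> W" and W: "finite W" "W \<subseteq> \<Gamma>" and j: "j \<in> S" "j \<in> \<Gamma>"
  shows "refinement_coeffs \<Gamma> A \<Lambda> c y j = (\<Sum>k\<in>W. y k * c (A *v k - j))"
  unfolding refinement_coeffs_def
proof (rule sum.mono_neutral_left)
  show "{k \<in> \<Gamma>. A *v k - j \<in> \<Lambda>} \<subseteq> W"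
  proof
    fix k assume k: "k \<in> {k \<in> \<Gamma>. A *v k - j \<in> \<Lambda>}"
    have "k = matrix_inv A *v (j + (A *v k - j))"
      by (simp add: matrix_inv_mult_vec[OF assms(1)])
    moreover have "j + (A *v k - j) \<in> {b + h |b h. b \<in> S \<and> h \<in> \<Lambda>}"
      using k j by blast
    ultimately have "k \<in> w_map A \<Lambda> S"
      unfolding w_map_def by (rule image_eqI)
    then show "k \<in> W"
      using sub k by blast
  qed
  show "\<forall>k\<in>W - {k \<in> \<Gamma>. A *v k - j \<in> \<Lambda>}. y k * c (A *v k - j) = 0"
  proof
    fix k assume k: "k \<in> W - {k \<in> \<Gamma>. A *v k - j \<in> \<Lambda>}"
    then have "A *v k - j \<in> \<Gamma> - \<Lambda>"
      using lattice_diff[OF assms(3) _ j(2)] assms(2) W(2) by blast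
    then show "y k * c (A *v k - j) = 0"
      using assms(4) by simp
  qed
qed (use W in simp)

text \<open>Expansions use the translates \<open>\<phi> (x + k)\<close>, whereas independence speaks of \<open>\<phi> (x - k)\<close>; the
  symmetry of the lattice under negation passes from one to the other.\<close>

lemma expansion_unique:
  assumes lattice: "is_lattice \<Gamma>" and indep: "independent_translates \<Gamma> \<phi>"
    and y: "\<forall>x. ((\<lambda>k. y k * \<phi> (x + k)) has_sum f x) \<Gamma>"
    and z: "\<forall>x. ((\<lambda>k. z k * \<phi> (x + k)) has_sum f x) \<Gamma>"
    and "k \<in> \<Gamma>"
  shows "y k = z k"
proof -
  have "((\<lambda>k. (y (- k) - z (- k)) * \<phi> (x - k)) has_sum 0) \<Gamma>" for x
  proof -
    have "((\<lambda>k. y k * \<phi> (x + k) + - (z k * \<phi> (x + k))) has_sum (f x + - f x)) \<Gamma>"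
      using y z by (intro has_sum_add has_sum_uminusI) auto
    then have "((\<lambda>k. (y k - z k) * \<phi> (x + k)) has_sum 0) \<Gamma>"
      by (simp add: left_diff_distrib)
    then show ?thesis
      by (subst has_sum_reindex_bij_witness[where i = uminus and j = uminus and T = \<Gamma>])
         (auto simp: lattice_uminus_iff[OF lattice])
  qed
  then have "\<forall>k\<in>\<Gamma>. y (- k) - z (- k) = 0"
    using indep unfolding independent_translates_def
    by (elim allE[of _ "\<lambda>k. y (- k) - z (- k)"]) blast
  then show ?thesis
    using lattice_uminus_iff[OF lattice, of k] \<open>k \<in> \<Gamma>\<close> by force
qed

text \<open>An eigenfunction has an eigenvalue \<open>\<mu> \<noteq> 0\<close>, because dilation is invertible, and by uniqueness its
  coefficient row \<open>y\<close> satisfies \<open>y T = \<mu> y\<close>.  If \<open>y\<close> vanished on \<open>\<Omega> n\<close>, then this equation would force it to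
  vanish on \<open>\<Omega> (n + 1)\<close>, on \<open>\<Omega> (n + 2)\<close>, and so on, hence on the whole lattice, and the function would
  be zero.  So the restriction of \<open>y\<close> to \<open>\<Omega> n\<close> is a left eigenvector of \<open>T\<^sub>n\<close>.\<close>

lemma eigenfunction_eigenvalue:
  fixes \<Gamma> \<Lambda> :: "(real ^ 'd::finite) set"
  assumes lattice: "is_lattice \<Gamma>" and A: "invertible A" "(\<lambda>x. A *v x) ` \<Gamma> \<subseteq> \<Gamma>"
    and Lambda: "finite \<Lambda>" "\<Lambda> \<subseteq> \<Gamma>" and c_zero: "\<forall>k\<in>\<Gamma> - \<Lambda>. c k = 0"
    and supp: "compactly_supported \<phi>"
    and refinement: "\<forall>x. \<phi> x = (\<Sum>k\<in>\<Lambda>. c k * \<phi> (A *v x - k))"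
    and indep: "independent_translates \<Gamma> \<phi>"
    and Omega: "\<forall>i. finite (\<Omega> i) \<and> \<Omega> i \<subseteq> \<Gamma>" "(\<Union>i. \<Omega> i) = \<Gamma>" "\<forall>i. \<Omega> i \<subseteq> \<Omega> (Suc i)"
    and adm: "\<forall>i. admissible \<Gamma> A \<Lambda> (\<Omega> i) \<and> w_map A \<Lambda> (\<Omega> (Suc i)) \<inter> \<Gamma> \<subseteq> \<Omega> i"
    and f: "f \<in> shift_space \<Gamma> \<phi>" "f x\<^sub>0 \<noteq> 0"
    and eigen: "\<forall>x. f (matrix_inv A *v x) = \<mu> * f x"
  shows "\<mu> \<in> eigenvalues_on (\<Omega> n) (\<lambda>i j. c (A *v i - j))"
proof -
  have "\<mu> \<noteq> 0"
  proof
    assume "\<mu> = 0"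
    then have "f (matrix_inv A *v (A *v x\<^sub>0)) = 0"
      using eigen by simp
    then show False
      using f(2) by (simp add: matrix_inv_mult_vec[OF A(1)])
  qed
  obtain y where y: "\<forall>x. ((\<lambda>k. y k * \<phi> (x + k)) has_sum f x) \<Gamma>"
    using f(1) by (auto simp: shift_space_def)
  have "\<forall>x. ((\<lambda>j. refinement_coeffs \<Gamma> A \<Lambda> c y j * \<phi> (x + j)) has_sum \<mu> * f x) \<Gamma>"
    using expansion_of_dilated[OF lattice A Lambda supp refinement y] eigen by simp
  moreover have "\<forall>x. ((\<lambda>j. \<mu> * y j * \<phi> (x + j)) has_sum \<mu> * f x) \<Gamma>"
    using y by (auto simp: mult.assoc intro!: has_sum_cmult_right)
  ultimately have row: "refinement_coeffs \<Gamma> A \<Lambda> c y j = \<mu> * y j" if "j \<in> \<Gamma>" for j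
    by (rule expansion_unique[OF lattice indep _ _ that, where z = "\<lambda>j. \<mu> * y j"])
  note coeffs = refinement_coeffs_eq_sum[OF A lattice c_zero]
  have "\<exists>j\<in>\<Omega> n. y j \<noteq> 0"
  proof (rule ccontr)
    assume contra: "\<not> (\<exists>j\<in>\<Omega> n. y j \<noteq> 0)"
    have later: "\<forall>j\<in>\<Omega> i. y j = 0" if "n \<le> i" for i
      using that
    proof (induction i rule: dec_induct)
      case base
      then show ?case using contra by blast
    next
      case (step i)
      show ?case
      proof
        fix j assume j: "j \<in> \<Omega> (Suc i)"
        then have "j \<in> \<Gamma>"
          using Omega(1) by blast
        then have "\<mu> * y j = (\<Sum>k\<in>\<Omega> i. y k * c (A *v k - j))"
          using row[of j] coeffs[of "\<Omega> (Suc i)" "\<Omega> i" j y] adm Omega(1) j by simp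
        also have "\<dots> = 0"
          using step.IH by simp
        finally show "y j = 0"
          using \<open>\<mu> \<noteq> 0\<close> by simp
      qed
    qed
    have "y j = 0" if "j \<in> \<Gamma>" for j
    proof -
      obtain i where "j \<in> \<Omega> i"
        using \<open>j \<in> \<Gamma>\<close> Omega(2) by blast
      moreover have "\<Omega> i \<subseteq> \<Omega> (max n i)"
        using lift_Suc_mono_le[of \<Omega>] Omega(3) by simp
      ultimately show ?thesis
        using later[of "max n i"] by auto
    qed
    then have "((\<lambda>k. y k * \<phi> (x\<^sub>0 + k)) has_sum 0) \<Gamma>"
      by (intro has_sum_0) simp
    then show False
      using y f(2) has_sum_unique by blast
  qed
  then obtain i\<^sub>0 where "i\<^sub>0 \<in> \<Omega> n" "y i\<^sub>0 \<noteq> 0"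
    by blast
  then show ?thesis
  proof (rule left_eigenvector_imp_eigenvalue[rotated])
    show "finite (\<Omega> n)"
      using Omega(1) by simp
    show "\<forall>j\<in>\<Omega> n. (\<Sum>i\<in>\<Omega> n. y i * c (A *v i - j)) = \<mu> * y j"
    proof
      fix j assume j: "j \<in> \<Omega> n"
      have "w_map A \<Lambda> (\<Omega> n) \<inter> \<Gamma> \<subseteq> \<Omega> n" "finite (\<Omega> n)" "\<Omega> n \<subseteq> \<Gamma>"
        using adm Omega(1) by (auto simp: admissible_def)
      then show "(\<Sum>i\<in>\<Omega> n. y i * c (A *v i - j)) = \<mu> * y j"
        using coeffs[of "\<Omega> n" "\<Omega> n" j y] row[of j] j by (simp add: subsetD)
    qed
  qed
qed

section \<open>Homogeneous decomposition of polynomials\<close>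

theorem theorem5p1:
  fixes \<Gamma> \<Lambda> \<Lambda>' D :: "(real ^ 'd::finite) set"
    and A :: "real ^ 'd ^ 'd"
    and c :: "real ^ 'd \<Rightarrow> complex"
    and \<phi> q :: "real ^ 'd \<Rightarrow> complex"
    and \<Omega> :: "nat \<Rightarrow> (real ^ 'd) set"
    and \<kappa> n n\<^sub>0 :: nat
    and \<Delta> :: "complex set"
  assumes lattice: "is_lattice \<Gamma>"
    and dilation: "is_dilation_matrix \<Gamma> A"
    and Lambda: "finite \<Lambda>" "\<Lambda> \<noteq> {}" "\<Lambda> \<subseteq> \<Gamma>"
    and c_zero: "\<forall>k\<in>\<Gamma> - \<Lambda>. c k = 0"
    and phi_supp: "compactly_supported \<phi>"
    and refinement: "\<forall>x. \<phi> x = (\<Sum>k\<in>\<Lambda>. c k * \<phi> (A *v x - k))"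
    and D_reps: "full_representatives \<Gamma> A D" "0 \<in> D"
    and D_tiles: "tiles_by \<Gamma> (attractor A D)"
    and Lambda'_def: "\<Lambda>' = minus_set \<Lambda> D"
    and Omega_fin: "\<forall>i. finite (\<Omega> i) \<and> \<Omega> i \<subseteq> \<Gamma>"
    and Omega_0: "\<Omega> 0 = lattice_attractor \<Gamma> A \<Lambda>"
    and Omega_mono: "\<forall>i. \<Omega> i \<subset> \<Omega> (Suc i)"
    and Omega_union: "(\<Union>i. \<Omega> i) = \<Gamma>"
    and Omega_adm: "\<forall>i. admissible \<Gamma> A \<Lambda> (\<Omega> i) \<and> w_map A \<Lambda> (\<Omega> (Suc i)) \<inter> \<Gamma> \<subseteq> \<Omega> i"
    and Omega_n0: "\<Omega> n\<^sub>0 = lattice_attractor \<Gamma> A \<Lambda>'"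
    and Omega_adm': "\<forall>i\<ge>n\<^sub>0. admissible \<Gamma> A \<Lambda>' (\<Omega> i) \<and> w_map A \<Lambda>' (\<Omega> (Suc i)) \<inter> \<Gamma> \<subseteq> \<Omega> i"
    and accuracy: "has_accuracy \<Gamma> \<phi> \<kappa>"
    and independent: "independent_translates \<Gamma> \<phi>"
    and Delta_def: "\<Delta> = eigenvalues_on (\<Omega> n) (\<lambda>i j. c (A *v i - j))"
    and q_poly: "homogeneous_poly q" "poly_degree_less \<kappa> q"
  shows "independent_spaces \<Delta> (H_space \<Gamma> A \<phi>) \<and> q \<in> sum_of_spaces \<Delta> (H_space \<Gamma> A \<phi>)"
proof
  have AG: "(\<lambda>x. A *v x) ` \<Gamma> \<subseteq> \<Gamma>"
    using dilation by (simp add: is_dilation_matrix_def)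
  have inv: "invertible A"
    using dilation by (rule dilation_matrix_invertible)
  let ?s = "\<lambda>x. matrix_inv A *v x"
  show "independent_spaces \<Delta> (H_space \<Gamma> A \<phi>)"
    unfolding independent_spaces_def
  proof (intro allI impI)
    fix F h
    assume Fh: "finite F \<and> F \<subseteq> \<Delta> \<and> (\<forall>z\<in>F. h z \<in> H_space \<Gamma> A \<phi> z) \<and> (\<forall>x. (\<Sum>z\<in>F. h z x) = 0)"
    then have "\<forall>z\<in>F. \<exists>k. \<forall>x. poly_action ?s ([:-z, 1:] ^ k) (h z) x = 0"
      unfolding H_space_def homogeneity_class_iff_poly_action by blast
    from bchoice[OF this] obtain r
      where r: "\<forall>z\<in>F. \<forall>x. poly_action ?s ([:-z, 1:] ^ r z) (h z) x = 0" ..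
    show "\<forall>z\<in>F. \<forall>x. h z x = 0"
    proof (intro ballI allI)
      fix z x assume "z \<in> F"
      then show "h z x = 0"
        using Fh by (intro generalized_eigenfunctions_independent[OF _ r]) simp_all
    qed
  qed
  \<comment> \<open>Accuracy puts all polynomials obtained from \<open>q\<close> into the shift space, not only \<open>q\<close> itself.\<close>
  have in_S: "poly_action ?s p q \<in> shift_space \<Gamma> \<phi>" for p
    using accuracy poly_degree_less_poly_action[OF q_poly(2)] by (simp add: has_accuracy_def)
  obtain p where "p \<noteq> 0" "\<forall>x. poly_action ?s p q x = 0"
    using poly_degree_less_annihilated[OF q_poly(2)] by blast
  then obtain F g r where F: "finite F"
    and decomp: "\<And>x. q x = (\<Sum>z\<in>F. poly_action ?s (g z) q x)"
    and r: "\<And>z. z \<in> F \<Longrightarrow> r z \<ge> (1::nat)"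
    and nonzero: "\<And>z. z \<in> F \<Longrightarrow> \<exists>x. poly_action ?s (g z) q x \<noteq> 0"
    and kill: "\<And>z x. z \<in> F \<Longrightarrow> poly_action ?s ([:-z, 1:] ^ r z) (poly_action ?s (g z) q) x = 0"
    by (rule annihilated_decomposition) (rule that)
  have "z \<in> \<Delta>" if "z \<in> F" for z
  proof -
    obtain x\<^sub>0 where "poly_action ?s (g z) q x\<^sub>0 \<noteq> 0"
      using nonzero[OF \<open>z \<in> F\<close>] by blast
    from eigenfunction_of_generalized[OF allI[OF kill[OF that]] this]
    obtain p' x\<^sub>1 where "poly_action ?s p' (poly_action ?s (g z) q) x\<^sub>1 \<noteq> 0"
      "\<forall>x. poly_action ?s p' (poly_action ?s (g z) q) (?s x)
        = z * poly_action ?s p' (poly_action ?s (g z) q) x"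
      by blast
    then have e: "poly_action ?s (p' * g z) q x\<^sub>1 \<noteq> 0"
      "\<forall>x. poly_action ?s (p' * g z) q (?s x) = z * poly_action ?s (p' * g z) q x"
      unfolding poly_action_mult .
    show ?thesis
      unfolding Delta_def
      by (rule eigenfunction_eigenvalue[OF lattice inv AG Lambda(1,3) c_zero phi_supp refinement
            independent Omega_fin Omega_union _ Omega_adm in_S e])
         (use Omega_mono in blast)
  qed
  moreover have "poly_action ?s (g z) q \<in> H_space \<Gamma> A \<phi> z" if "z \<in> F" for z
    using in_S r[OF that] kill[OF that]
    by (auto simp: H_space_def homogeneity_class_iff_poly_action)
  moreover have "q = (\<lambda>x. \<Sum>z\<in>F. poly_action ?s (g z) q x)"
    using decomp by blast
  ultimately show "q \<in> sum_of_spaces \<Delta> (H_space \<Gamma> A \<phi>)"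
    using F unfolding sum_of_spaces_def
    by (intro CollectI exI[of _ F] exI[of _ "\<lambda>z. poly_action ?s (g z) q"]) auto
qed

end
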